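(* (Strong duality) Let $K\subseteq\mathbb{R}^k$ be a nontrivial pointed closed convex cone, let $L\in\mathbb{R}^{k\times n}$, $A\in\mathbb{R}^{m\times n}$, $b\in\mathbb{R}^m$, let $\mathcal{A}=\{x\in\mathbb{R}^n_+ : Ax=b\}$ and $$\mathcal{B}=\{(\lambda,U,v)\in K^{*0}\times\mathbb{R}^{k\times m}\times\mathbb{R}^k : \lambda^Tv=0 \text{ and } (L-UA)^T\lambda\in\mathbb{R}^n_+\}.$$ Let $(P)$ be the problem of vector-minimizing $Lx$ over $x\in\mathcal{A}$, and $(D)$ the problem of vector-maximizing $h(\lambda,U,v)=Ub+v$ over $(\lambda,U,v)\in\mathcal{B}$, both with respect to the partial ordering induced by $K$. If $\bar x$ is an efficient solution to $(P)$, then there exists $(\bar\lambda,\bar U,\bar v)\in\mathcal{B}$, an efficient solution to $(D)$, such that $L\bar x=\bar Ub+\bar v$.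
   Context: $\mathbb{R}^n_+$ denotes the nonnegative orthant. A set $K\subseteq\mathbb{R}^k$ is a cone if $\lambda K\subseteq K$ for all $\lambda\geq 0$; it is nontrivial if $K\neq\{0\}$ and $K\neq\mathbb{R}^k$, and pointed if $K\cap(-K)=\{0\}$. Write $v\leqq_K w$ if $w-v\in K$, and $v\leq_K w$ if $v\leqq_K w$ and $v\neq w$. Set $K^{*0}=\{\lambda\in\mathbb{R}^k:\lambda^Tv>0\ \forall v\in K\setminus\{0\}\}$. An element $\bar x\in\mathcal{A}$ is an efficient solution to $(P)$ if there is no $x\in\mathcal{A}$ with $Lx\leq_K L\bar x$. An element $(\bar\lambda,\bar U,\bar v)\in\mathcal{B}$ is an efficient solution to $(D)$ if there is no $(\lambda,U,v)\in\mathcal{B}$ with $\bar Ub+\bar v\leq_K Ub+v$. *)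

theory Defs
  imports "HOL-Analysis.Analysis"
begin

definition nonneg_orthant :: "(real ^ 'n) set" where
  "nonneg_orthant = {x. \<forall>i. 0 \<le> x $ i}"

definition nontrivial_cone :: "'a::real_vector set \<Rightarrow> bool" where
  "nontrivial_cone K \<longleftrightarrow> cone K \<and> K \<noteq> {0} \<and> K \<noteq> UNIV"

definition pointed_cone :: "'a::real_vector set \<Rightarrow> bool" where
  "pointed_cone K \<longleftrightarrow> cone K \<and> K \<inter> uminus ` K = {0}"

definition cone_leqq :: "'a::real_vector set \<Rightarrow> 'a \<Rightarrow> 'a \<Rightarrow> bool" where
  "cone_leqq K v w \<longleftrightarrow> w - v \<in> K"

(* The irreflexive part of cone_leqq; it is not the order induced by the interior of K. *)
definition cone_leq :: "'a::real_vector set \<Rightarrow> 'a \<Rightarrow> 'a \<Rightarrow> bool" where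
  "cone_leq K v w \<longleftrightarrow> cone_leqq K v w \<and> v \<noteq> w"

(* The set K^{*0} of functionals that are strictly positive on K without the origin. *)
definition strict_dual_cone :: "'a::real_inner set \<Rightarrow> 'a set" where
  "strict_dual_cone K = {l. \<forall>v \<in> K - {0}. 0 < l \<bullet> v}"

definition efficient_min :: "'b::real_vector set \<Rightarrow> ('a \<Rightarrow> 'b) \<Rightarrow> 'a set \<Rightarrow> 'a \<Rightarrow> bool" where
  "efficient_min K f S x \<longleftrightarrow> x \<in> S \<and> \<not> (\<exists>y \<in> S. cone_leq K (f y) (f x))"

definition efficient_max :: "'b::real_vector set \<Rightarrow> ('a \<Rightarrow> 'b) \<Rightarrow> 'a set \<Rightarrow> 'a \<Rightarrow> bool" where
  "efficient_max K f S x \<longleftrightarrow> x \<in> S \<and> \<not> (\<exists>y \<in> S. cone_leq K (f x) (f y))"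

(* Matrices with k rows and n columns have type real ^ 'n ^ 'k. *)
definition primal_feasible :: "real ^ 'n ^ 'm \<Rightarrow> real ^ 'm \<Rightarrow> (real ^ 'n) set" where
  "primal_feasible A b = {x \<in> nonneg_orthant. A *v x = b}"

definition dual_feasible ::
  "(real ^ 'k) set \<Rightarrow> real ^ 'n ^ 'k \<Rightarrow> real ^ 'n ^ 'm \<Rightarrow>
    ((real ^ 'k) \<times> (real ^ 'm ^ 'k) \<times> (real ^ 'k)) set" where
  "dual_feasible K L A =
    {(l, U, v). l \<in> strict_dual_cone K \<and> l \<bullet> v = 0 \<and>
                transpose (L - U ** A) *v l \<in> nonneg_orthant}"

definition dual_objective ::
  "real ^ 'm \<Rightarrow> (real ^ 'k) \<times> (real ^ 'm ^ 'k) \<times> (real ^ 'k) \<Rightarrow> real ^ 'k" where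
  "dual_objective b = (\<lambda>(l, U, v). U *v b + v)"

end

theory Submission
  imports Defs
begin

text \<open>
  An efficient point \<open>x\<close> of the polyhedral problem is properly efficient: if \<open>T\<close> is the cone of
  feasible directions at \<open>x\<close>, then \<open>L T\<close> is a finitely generated, hence closed, cone meeting \<open>-K\<close> only in
  the origin. The convex hull of the unit vectors of \<open>K\<close> is compact and avoids \<open>-L T\<close>, and
  separating the two gives \<open>\<lambda> \<in> K\<^sup>*\<^sup>0\<close> that is nonnegative on \<open>L T\<close>. Farkas' lemma yields \<open>u\<close> with
  \<open>L\<^sup>T \<lambda> - A\<^sup>T u\<close> nonnegative and complementary to \<open>x\<close>, and the rank-one matrix
  \<open>U = \<lambda> u\<^sup>T / |\<lambda>|\<^sup>2\<close> with \<open>v = L x - U b\<close> is the required dual solution. It is efficient by weak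
  duality.
\<close>

section \<open>Pointed cones and separation from convex cones\<close>

lemma convex_pointed_cone_minus_zero:
  assumes "pointed_cone K" "convex K"
  shows "convex (K - {0})"
proof (rule convexI)
  fix x y and u v :: real
  assume x: "x \<in> K - {0}" and y: "y \<in> K - {0}" and uv: "0 \<le> u" "0 \<le> v" "u + v = 1"
  have cone: "cone K" using assms(1) by (simp add: pointed_cone_def)
  have ux: "u *\<^sub>R x \<in> K" and vy: "v *\<^sub>R y \<in> K"
    using cone x y uv by (auto simp: cone_def)
  have "u *\<^sub>R x + v *\<^sub>R y \<noteq> 0"
  proof
    assume "u *\<^sub>R x + v *\<^sub>R y = 0"
    then have eq: "u *\<^sub>R x = - (v *\<^sub>R y)" by (simp add: eq_neg_iff_add_eq_0)
    then have "u *\<^sub>R x \<in> K \<inter> uminus ` K" using ux vy by blast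
    then have ux0: "u *\<^sub>R x = 0" using assms(1) unfolding pointed_cone_def by blast
    then have "v *\<^sub>R y = 0" using eq by simp
    then show False using ux0 x y uv by simp
  qed
  then show "u *\<^sub>R x + v *\<^sub>R y \<in> K - {0}"
    using convexD[OF assms(2) _ _ uv] x y by simp
qed

text \<open>A negative value could be scaled below any bound. This turns the strict bounds supplied
  by separation theorems into sign conditions.\<close>

lemma nonneg_on_cone_if_bounded_below:
  assumes "convex_cone C" "y \<in> C" and bd: "\<And>z. z \<in> C \<Longrightarrow> c < a \<bullet> z"
  shows "0 \<le> a \<bullet> y"
proof (rule ccontr)
  assume neg: "\<not> 0 \<le> a \<bullet> y"
  \<comment> \<open>Chosen so that \<open>a\<close> takes the value \<open>- \<bar>c\<bar>\<close>,
    hence at most \<open>c\<close>, at \<open>t *\<^sub>R y\<close>.\<close>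
  define t where "t = \<bar>c\<bar> / - (a \<bullet> y)"
  have "t \<ge> 0" using neg by (simp add: t_def divide_nonneg_neg)
  then have "t *\<^sub>R y \<in> C" using assms by (simp add: convex_cone_scaleR)
  from bd[OF this] have "c < t * (a \<bullet> y)" by simp
  also have "t * (a \<bullet> y) = - \<bar>c\<bar>" using neg by (simp add: t_def)
  finally show False by linarith
qed

lemma separating_hyperplane_closed_convex_cone:
  fixes C :: "'a::euclidean_space set"
  assumes "convex_cone C" "closed C" "x \<notin> C"
  obtains a where "a \<bullet> x < 0" "\<And>y. y \<in> C \<Longrightarrow> 0 \<le> a \<bullet> y"
proof -
  obtain a c where ac: "a \<bullet> x < c" "\<forall>y\<in>C. c < a \<bullet> y"
    using separating_hyperplane_closed_point[of C x] assms by (auto simp: convex_cone_def)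
  then have "c < 0" using convex_cone_contains_0[OF assms(1)] by force
  show thesis
  proof (rule that)
    show "a \<bullet> x < 0" using ac(1) \<open>c < 0\<close> by linarith
    show "0 \<le> a \<bullet> y" if "y \<in> C" for y
      using nonneg_on_cone_if_bounded_below[OF assms(1) that] ac(2) by blast
  qed
qed

section \<open>Finitely generated and polyhedral cones\<close>

lemma convex_cone_nonneg_set: "convex_cone {d. \<forall>f\<in>F. 0 \<le> f \<bullet> d}"
  by (simp add: convex_cone_iff inner_add_right)

lemma nonneg_on_convex_cone_hull:
  assumes "\<forall>f\<in>F. 0 \<le> f \<bullet> d" "y \<in> convex_cone hull F"
  shows "0 \<le> y \<bullet> d"
proof -
  have "convex_cone hull F \<subseteq> {y. 0 \<le> d \<bullet> y}"
    using assms(1) by (intro hull_minimal convex_cone_halfspace_ge) (auto simp: inner_commute)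
  then show ?thesis using assms(2) by (auto simp: inner_commute)
qed

text \<open>A finitely generated cone is closed, so a point \<open>c\<close> outside it could be
  separated by some \<open>a\<close> that is nonnegative on \<open>F\<close> but negative against
  \<open>c\<close>.\<close>

lemma Farkas_convex_cone_hull:
  fixes F :: "'a::euclidean_space set"
  assumes "finite F" and "\<And>d. \<forall>f\<in>F. 0 \<le> f \<bullet> d \<Longrightarrow> 0 \<le> c \<bullet> d"
  shows "c \<in> convex_cone hull F"
proof (rule ccontr)
  assume "c \<notin> convex_cone hull F"
  then obtain a where "a \<bullet> c < 0" and a: "\<And>y. y \<in> convex_cone hull F \<Longrightarrow> 0 \<le> a \<bullet> y"
    using separating_hyperplane_closed_convex_cone convex_cone_convex_cone_hull
      closed_convex_cone_hull[OF assms(1)] by metis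
  moreover have "\<forall>f\<in>F. 0 \<le> f \<bullet> a" using a by (simp add: hull_inc inner_commute)
  ultimately show False using assms(2)[of a] by (simp add: inner_commute)
qed

text \<open>Minkowski's theorem, by duality from the fact that \<open>convex_cone hull F\<close> is a polyhedron:
  the generators are the inner normals of its half-spaces.\<close>

lemma polyhedral_cone_finitely_generated:
  fixes F :: "'a::euclidean_space set"
  assumes "finite F"
  obtains G where "finite G" "{d. \<forall>f\<in>F. 0 \<le> f \<bullet> d} = convex_cone hull G"
proof -
  let ?P = "convex_cone hull F"
  obtain H where H: "finite H" "?P = \<Inter>H"
    and "\<forall>h\<in>H. \<exists>a b. a \<noteq> 0 \<and> h = {x. a \<bullet> x \<le> b}"
    using polyhedron_convex_cone_hull[OF assms] unfolding polyhedron_def by blast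
  then obtain a b where ab: "\<And>h. h \<in> H \<Longrightarrow> h = {x. a h \<bullet> x \<le> b h}" by metis
  define G where "G = (\<lambda>h. - a h) ` H"
  have "finite G" using H by (simp add: G_def)
  have P_G: "0 \<le> g \<bullet> x" if x: "x \<in> ?P" and g: "g \<in> G" for x g
  proof -
    obtain h where h: "h \<in> H" "g = - a h" using g by (auto simp: G_def)
    \<comment> \<open>Subtracting 1 makes the half-space bound strict, as
      \<open>nonneg_on_cone_if_bounded_below\<close> demands.\<close>
    have "- b h - 1 < g \<bullet> z" if "z \<in> ?P" for z
    proof -
      have "z \<in> h" using that h(1) H(2) by blast
      then have "a h \<bullet> z \<le> b h" using ab[OF h(1)] by blast
      then show ?thesis using h(2) by simp
    qed
    then show ?thesis
      using nonneg_on_cone_if_bounded_below[OF convex_cone_convex_cone_hull x] by blast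
  qed
  have G_P: "x \<in> ?P" if x: "\<forall>g\<in>G. 0 \<le> g \<bullet> x" for x
  proof -
    have "x \<in> h" if "h \<in> H" for h
    proof -
      \<comment> \<open>The origin lies in each half-space, so its offset is nonnegative and the
        homogeneous inequality suffices.\<close>
      have "0 \<in> h" using that H(2) convex_cone_hull_contains_0 by blast
      then have "a h \<bullet> 0 \<le> b h" using ab[OF that] by blast
      then have "0 \<le> b h" by simp
      moreover have "a h \<bullet> x \<le> 0" using x that by (auto simp: G_def)
      ultimately show ?thesis by (subst ab[OF that]) simp
    qed
    then show ?thesis using H(2) by blast
  qed
  have "{d. \<forall>f\<in>F. 0 \<le> f \<bullet> d} = convex_cone hull G"
  proof
    show "{d. \<forall>f\<in>F. 0 \<le> f \<bullet> d} \<subseteq> convex_cone hull G"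
    proof safe
      fix d assume d: "\<forall>f\<in>F. 0 \<le> f \<bullet> d"
      \<comment> \<open>Points nonnegative against \<open>G\<close> lie in \<open>?P\<close> by
        \<open>G_P\<close>, and \<open>d\<close> is nonnegative on \<open>?P\<close>: this is the
        Farkas hypothesis.\<close>
      show "d \<in> convex_cone hull G"
        using G_P nonneg_on_convex_cone_hull[OF d]
        by (intro Farkas_convex_cone_hull \<open>finite G\<close>) (simp add: inner_commute)
    qed
    show "convex_cone hull G \<subseteq> {d. \<forall>f\<in>F. 0 \<le> f \<bullet> d}"
    proof (intro hull_minimal convex_cone_nonneg_set subsetI CollectI ballI)
      fix g f assume "g \<in> G" "f \<in> F"
      then have "0 \<le> g \<bullet> f" using P_G by (simp add: hull_inc)
      then show "0 \<le> f \<bullet> g" by (simp add: inner_commute)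
    qed
  qed
  then show thesis using that \<open>finite G\<close> by blast
qed

text \<open>Linear images of closed cones can fail to be closed; here the images of the finitely
  many generators generate the image.\<close>

lemma closed_linear_image_polyhedral_cone:
  fixes f :: "'a::euclidean_space \<Rightarrow> 'b::euclidean_space"
  assumes "finite F" "linear f"
  shows "closed (f ` {d. \<forall>f\<in>F. 0 \<le> f \<bullet> d})"
proof -
  obtain G where "finite G" "{d. \<forall>f\<in>F. 0 \<le> f \<bullet> d} = convex_cone hull G"
    using polyhedral_cone_finitely_generated[OF assms(1)] by blast
  then show ?thesis
    using assms(2) by (simp add: closed_convex_cone_hull flip: convex_cone_hull_linear_image)
qed

text \<open>Strictness comes from compactness: \<open>l\<close> is strictly positive on the compact
  set \<open>B\<close>, which meets every ray of \<open>K\<close>, and scaling extends this to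
  \<open>K - {0}\<close>.\<close>

lemma strict_dual_cone_separation:
  fixes K M :: "'a::euclidean_space set"
  assumes "pointed_cone K" "closed K" "convex K"
    and "convex_cone M" "closed M"
    and disj: "M \<inter> uminus ` K \<subseteq> {0}"
  obtains l where "l \<in> strict_dual_cone K" "\<And>y. y \<in> M \<Longrightarrow> 0 \<le> l \<bullet> y"
proof -
  have cone: "cone K" using assms(1) by (simp add: pointed_cone_def)
  define B where "B = convex hull (K \<inter> sphere 0 1)"
  have compB: "compact B"
    unfolding B_def using assms(2) by (intro compact_convex_hull closed_Int_compact) auto
  have BK: "B \<subseteq> K - {0}"
    unfolding B_def using convex_pointed_cone_minus_zero[OF assms(1,3)]
    by (intro hull_minimal) auto
  show thesis
  proof (cases "B = {}")
    \<comment> \<open>The separation theorem needs a nonempty compact set. Here \<open>K\<close> has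
      no nonzero vector, so even \<open>l = 0\<close> qualifies.\<close>
    case True
    then have emp: "K \<inter> sphere 0 1 = {}" by (simp add: B_def)
    have "K - {0} = {}"
    proof (rule ccontr)
      assume "K - {0} \<noteq> {}"
      then obtain v where "v \<in> K" "v \<noteq> 0" by blast
      then have "(1 / norm v) *\<^sub>R v \<in> K \<inter> sphere 0 1" using cone by (auto simp: cone_def)
      then show False using emp by blast
    qed
    then show ?thesis by (intro that[of 0]) (auto simp: strict_dual_cone_def)
  next
    case False
    have "uminus ` B \<inter> M = {}" using BK disj by fastforce
    moreover have "convex (uminus ` B)" "compact (uminus ` B)" "uminus ` B \<noteq> {}"
      using compB False by (auto simp: B_def intro: convex_negations compact_negations)
    ultimately obtain l c where lB: "\<forall>x\<in>uminus ` B. l \<bullet> x < c" and lM: "\<forall>x\<in>M. c < l \<bullet> x"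
      using separating_hyperplane_compact_closed[of "uminus ` B" M] assms by (auto simp: convex_cone_def)
    have "c < 0" using lM convex_cone_contains_0[OF assms(4)] by force
    show ?thesis
    proof (rule that)
      show "l \<in> strict_dual_cone K"
        unfolding strict_dual_cone_def
      proof (intro CollectI ballI)
        fix v assume "v \<in> K - {0}"
        then have v: "v \<in> K" "v \<noteq> 0" by auto
        then have "(1 / norm v) *\<^sub>R v \<in> K \<inter> sphere 0 1" using cone by (auto simp: cone_def)
        then have "(1 / norm v) *\<^sub>R v \<in> B" unfolding B_def by (rule hull_inc)
        then have "0 < l \<bullet> ((1 / norm v) *\<^sub>R v)" using lB \<open>c < 0\<close> by force
        then show "0 < l \<bullet> v" using v by (simp add: zero_less_divide_iff)
      qed
    next
      fix y assume "y \<in> M"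
      then show "0 \<le> l \<bullet> y"
        by (rule nonneg_on_cone_if_bounded_below[OF assms(4)]) (use lM in blast)
    qed
  qed
qed

section \<open>Feasible directions and multipliers\<close>

lemma inner_transpose_mult:
  fixes A :: "real ^ 'n ^ 'm"
  shows "(transpose A *v u) \<bullet> x = u \<bullet> (A *v x)"
  by (simp add: dot_lmul_matrix)

text \<open>Each equation of \<open>A *v d = 0\<close> is encoded as two opposite inequalities, so
  that the results on finite families of half-spaces apply.\<close>

definition feasible_direction_normals :: "real ^ 'n ^ 'm \<Rightarrow> 'n set \<Rightarrow> (real ^ 'n) set" where
  "feasible_direction_normals A I =
    (\<lambda>i. axis i 1) ` I \<union> range (\<lambda>j. A $ j) \<union> range (\<lambda>j. - (A $ j))"

lemma finite_feasible_direction_normals: "finite (feasible_direction_normals A I)"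
  by (simp add: feasible_direction_normals_def)

lemma nonneg_feasible_direction_normals_iff:
  "(\<forall>f\<in>feasible_direction_normals A I. 0 \<le> f \<bullet> d) \<longleftrightarrow> A *v d = 0 \<and> (\<forall>i\<in>I. 0 \<le> d $ i)"
proof -
  have "A *v d = 0 \<longleftrightarrow> (\<forall>j. A $ j \<bullet> d = 0)"
    by (simp add: vec_eq_iff matrix_vector_mult_def inner_vec_def)
  then show ?thesis
    by (auto simp: feasible_direction_normals_def ball_Un inner_axis' intro: order_antisym)
qed

text \<open>The vectors with such a representation form a convex cone \<open>C\<close> containing
  the normals, so it contains their hull, where Farkas places \<open>c\<close>. With
  \<open>I\<close> the zero coordinates of a feasible point, the vanishing of \<open>s\<close> off
  \<open>I\<close> is complementary slackness.\<close>

lemma Farkas_partial_sign: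
  fixes A :: "real ^ 'n ^ 'm"
  assumes "\<And>d. A *v d = 0 \<Longrightarrow> \<forall>i\<in>I. 0 \<le> d $ i \<Longrightarrow> 0 \<le> c \<bullet> d"
  obtains u s where "c = transpose A *v u + s" "\<forall>i\<in>I. 0 \<le> s $ i" "\<forall>i\<in>-I. s $ i = 0"
proof -
  define C where "C = {transpose A *v u + s | u s. (\<forall>i\<in>I. 0 \<le> s $ i) \<and> (\<forall>i\<in>-I. s $ i = 0)}"
  have memI: "y \<in> C" if "y = transpose A *v u + s" "\<forall>i\<in>I. 0 \<le> s $ i" "\<forall>i\<in>-I. s $ i = 0" for y u s
    using that unfolding C_def by blast
  have "convex_cone C"
    unfolding convex_cone_iff
  proof (intro conjI ballI allI impI)
    show "0 \<in> C" by (rule memI[of _ 0 0]) auto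
  next
    fix x y assume "x \<in> C" "y \<in> C"
    then obtain u s u' s' where "x = transpose A *v u + s" "y = transpose A *v u' + s'"
      "\<forall>i\<in>I. 0 \<le> s $ i" "\<forall>i\<in>-I. s $ i = 0" "\<forall>i\<in>I. 0 \<le> s' $ i" "\<forall>i\<in>-I. s' $ i = 0"
      unfolding C_def by blast
    then show "x + y \<in> C"
      by (intro memI[of _ "u + u'" "s + s'"])
        (auto simp: matrix_vector_right_distrib simp del: transpose_matrix_vector)
  next
    fix x and t :: real assume "x \<in> C" "0 \<le> t"
    then obtain u s where "x = transpose A *v u + s" "\<forall>i\<in>I. 0 \<le> s $ i" "\<forall>i\<in>-I. s $ i = 0"
      unfolding C_def by blast
    then show "t *\<^sub>R x \<in> C"
      using \<open>0 \<le> t\<close> by (intro memI[of _ "t *\<^sub>R u" "t *\<^sub>R s"])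
        (auto simp: scaleR_add_right matrix_vector_mult_scaleR simp del: transpose_matrix_vector)
  qed
  moreover have "feasible_direction_normals A I \<subseteq> C"
  proof -
    have row: "A $ j = transpose A *v axis j 1" for j
      by (simp add: matrix_vector_mult_basis column_def transpose_def vec_eq_iff
          del: transpose_matrix_vector)
    have "axis i 1 \<in> C" if "i \<in> I" for i
      by (rule memI[of _ 0 "axis i 1"]) (use that in \<open>auto simp: axis_def\<close>)
    moreover have "A $ j \<in> C" for j
      by (rule memI[of _ "axis j 1" 0]) (use row in auto)
    moreover have "- (A $ j) \<in> C" for j
    proof (rule memI[of _ "(- 1) *\<^sub>R axis j 1" 0])
      show "- (A $ j) = transpose A *v ((- 1) *\<^sub>R axis j 1) + 0"
        unfolding matrix_vector_mult_scaleR row[of j] by (simp del: transpose_matrix_vector)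
    qed auto
    ultimately show ?thesis by (auto simp: feasible_direction_normals_def)
  qed
  moreover have "c \<in> convex_cone hull feasible_direction_normals A I"
    using assms
    by (intro Farkas_convex_cone_hull finite_feasible_direction_normals)
      (simp add: nonneg_feasible_direction_normals_iff)
  ultimately have "c \<in> C" using hull_minimal[of _ C convex_cone] by blast
  then show thesis using that unfolding C_def by blast
qed

text \<open>Zero coordinates stay nonnegative for every positive \<open>t\<close>, positive ones for
  small \<open>t\<close> by continuity; finitely many coordinates admit a common
  \<open>t\<close>.\<close>

lemma feasible_direction_step:
  fixes x d :: "real ^ 'n"
  assumes "\<forall>i. 0 \<le> x $ i" "\<forall>i. x $ i = 0 \<longrightarrow> 0 \<le> d $ i"
  obtains t where "t > 0" "\<forall>i. 0 \<le> (x + t *\<^sub>R d) $ i"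
proof -
  have "\<forall>\<^sub>F t in at_right 0. 0 \<le> (x + t *\<^sub>R d) $ i" for i
  proof (cases "x $ i = 0")
    case True
    then show ?thesis using assms(2)
      by (auto intro!: eventually_mono[OF eventually_at_right_less[of 0]])
  next
    case False
    have "((\<lambda>t. x $ i + t * d $ i) \<longlongrightarrow> x $ i + 0 * d $ i) (at_right 0)"
      by (intro tendsto_intros)
    moreover have "0 < x $ i" using False assms(1) by (simp add: less_le)
    ultimately have "\<forall>\<^sub>F t in at_right 0. 0 < x $ i + t * d $ i"
      by (auto dest: order_tendstoD(1))
    then show ?thesis by eventually_elim simp
  qed
  then have "\<forall>\<^sub>F t in at_right 0. \<forall>i. 0 \<le> (x + t *\<^sub>R d) $ i"
    by (intro eventually_all_finite)
  then have "\<forall>\<^sub>F t in at_right 0. 0 < t \<and> (\<forall>i. 0 \<le> (x + t *\<^sub>R d) $ i)"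
    using eventually_at_right_less by (rule eventually_elim2) auto
  then show thesis using that eventually_happens'[OF trivial_limit_at_right_real] by blast
qed

section \<open>Weak duality, scalarization and strong duality\<close>

lemma weak_duality:
  assumes x: "x \<in> primal_feasible A b" and y: "y \<in> dual_feasible K L A"
  shows "\<not> cone_leq K (L *v x) (dual_objective b y)"
proof
  obtain l U v where y_eq: "y = (l, U, v)" by (cases y)
  assume "cone_leq K (L *v x) (dual_objective b y)"
  then have "U *v b + v - L *v x \<in> K - {0}"
    by (auto simp: cone_leq_def cone_leqq_def dual_objective_def y_eq)
  then have "0 < l \<bullet> (U *v b + v - L *v x)"
    using y by (auto simp: y_eq dual_feasible_def strict_dual_cone_def)
  \<comment> \<open>Uses \<open>l \<bullet> v = 0\<close> and substitutes \<open>A *v x\<close> for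
    \<open>b\<close>.\<close>
  also have "\<dots> = - (l \<bullet> ((L - U ** A) *v x))"
    using x y by (simp add: y_eq dual_feasible_def primal_feasible_def inner_add_right
        inner_diff_right matrix_vector_mult_diff_rdistrib flip: matrix_vector_mul_assoc)
  also have "\<dots> = - ((transpose (L - U ** A) *v l) \<bullet> x)"
    by (simp only: inner_transpose_mult)
  also have "\<dots> \<le> 0"
    using x y by (auto simp: y_eq dual_feasible_def primal_feasible_def nonneg_orthant_def
        inner_vec_def simp del: transpose_matrix_vector intro!: sum_nonneg)
  finally show False by simp
qed

text \<open>If a feasible direction \<open>d\<close> had a nonzero image in \<open>-K\<close>, a
  short step along \<open>d\<close> would improve on \<open>x\<close>; so separation applies to the
  closed cone \<open>M\<close>.\<close>

lemma efficient_min_imp_scalarization: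
  fixes K :: "(real ^ 'k) set" and L :: "real ^ 'n ^ 'k" and A :: "real ^ 'n ^ 'm"
  assumes "pointed_cone K" "closed K" "convex K"
    and eff: "efficient_min K (\<lambda>x. L *v x) (primal_feasible A b) x"
  obtains l where "l \<in> strict_dual_cone K"
    "\<And>d. A *v d = 0 \<Longrightarrow> \<forall>i\<in>{i. x $ i = 0}. 0 \<le> d $ i \<Longrightarrow> 0 \<le> l \<bullet> (L *v d)"
proof -
  have cone: "cone K" using assms(1) by (simp add: pointed_cone_def)
  have xA: "\<forall>i. 0 \<le> x $ i" "A *v x = b"
    using eff by (auto simp: efficient_min_def primal_feasible_def nonneg_orthant_def)
  define T where "T = {d. \<forall>f\<in>feasible_direction_normals A {i. x $ i = 0}. 0 \<le> f \<bullet> d}"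
  define M where "M = (*v) L ` T"
  have T_iff: "d \<in> T \<longleftrightarrow> A *v d = 0 \<and> (\<forall>i\<in>{i. x $ i = 0}. 0 \<le> d $ i)" for d
    by (simp only: T_def mem_Collect_eq nonneg_feasible_direction_normals_iff)
  have closedM: "closed M"
    unfolding M_def T_def
    by (intro closed_linear_image_polyhedral_cone finite_feasible_direction_normals
        matrix_vector_mul_linear)
  have coneM: "convex_cone M"
    unfolding M_def T_def
    using convex_cone_linear_image convex_cone_nonneg_set matrix_vector_mul_linear by blast
  have disj: "M \<inter> uminus ` K \<subseteq> {0}"
  proof
    fix y assume "y \<in> M \<inter> uminus ` K"
    then obtain d where d: "d \<in> T" "y = L *v d" and "- y \<in> K" by (auto simp: M_def)
    obtain t where t: "t > 0" "\<forall>i. 0 \<le> (x + t *\<^sub>R d) $ i"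
      using feasible_direction_step[OF xA(1), of d] d(1) by (auto simp: T_iff)
    have "x + t *\<^sub>R d \<in> primal_feasible A b"
      using t d(1) xA(2) by (auto simp: primal_feasible_def nonneg_orthant_def T_iff
          matrix_vector_right_distrib matrix_vector_mult_scaleR)
    then have "\<not> cone_leq K (L *v (x + t *\<^sub>R d)) (L *v x)"
      using eff by (auto simp: efficient_min_def)
    moreover have "L *v x - L *v (x + t *\<^sub>R d) = t *\<^sub>R (- y)"
      by (simp add: d matrix_vector_right_distrib matrix_vector_mult_scaleR)
    moreover have "t *\<^sub>R (- y) \<in> K" using cone \<open>- y \<in> K\<close> t by (meson cone_def less_imp_le)
    \<comment> \<open>Efficiency forces the two objective values to coincide, so
      \<open>t *\<^sub>R (- y) = 0\<close>.\<close>
    ultimately show "y \<in> {0}" using t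
      by (auto simp: cone_leq_def cone_leqq_def)
  qed
  obtain l where l: "l \<in> strict_dual_cone K" "\<And>y. y \<in> M \<Longrightarrow> 0 \<le> l \<bullet> y"
    using strict_dual_cone_separation[OF assms(1-3) coneM closedM disj] by blast
  show thesis using that[OF l(1)] l(2) by (auto simp: M_def T_iff)
qed

text \<open>Turns the multiplier vector of the scalarized problem into a matrix, by an outer product
  normalized with \<open>l \<bullet> l\<close>.\<close>

lemma rank_one_matrix:
  fixes l :: "real ^ 'k" and u :: "real ^ 'm"
  assumes "l \<noteq> 0"
  obtains U :: "real ^ 'm ^ 'k" where "transpose U *v l = u"
proof
  let ?U = "\<chi> i j. l $ i * u $ j / (l \<bullet> l)"
  have "(transpose ?U *v l) $ j = (l \<bullet> l) * (u $ j / (l \<bullet> l))" for j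
    unfolding inner_vec_def[of l l] sum_distrib_right matrix_vector_mult_def transpose_def
    by (simp add: mult_ac)
  then show "transpose ?U *v l = u"
    using assms by (simp add: vec_eq_iff[of _ u] del: transpose_matrix_vector)
qed

theorem theorem3:
  fixes K :: "(real ^ 'k) set"
    and L :: "real ^ 'n ^ 'k"
    and A :: "real ^ 'n ^ 'm"
    and b :: "real ^ 'm"
    and xbar :: "real ^ 'n"
  assumes "nontrivial_cone K" and "pointed_cone K" and "closed K" and "convex K"
    and "efficient_min K (\<lambda>x. L *v x) (primal_feasible A b) xbar"
  shows "\<exists>lbar Ubar vbar.
    (lbar, Ubar, vbar) \<in> dual_feasible K L A \<and>
    efficient_max K (dual_objective b) (dual_feasible K L A) (lbar, Ubar, vbar) \<and>
    L *v xbar = Ubar *v b + vbar"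
proof -
  have feas: "xbar \<in> primal_feasible A b" using assms(5) by (simp add: efficient_min_def)
  then have xA: "A *v xbar = b" by (simp add: primal_feasible_def)
  obtain l where l: "l \<in> strict_dual_cone K"
    and lT: "\<And>d. A *v d = 0 \<Longrightarrow> \<forall>i\<in>{i. xbar $ i = 0}. 0 \<le> d $ i \<Longrightarrow> 0 \<le> l \<bullet> (L *v d)"
    using efficient_min_imp_scalarization[OF assms(2-5)] by blast
  \<comment> \<open>Nontriviality provides a nonzero vector of \<open>K\<close>, on which
    \<open>l\<close> is positive.\<close>
  have "l \<noteq> 0"
    using l assms(1,2) by (auto simp: strict_dual_cone_def nontrivial_cone_def pointed_cone_def)
  obtain u s where us: "transpose L *v l = transpose A *v u + s"
    and s: "\<forall>i\<in>{i. xbar $ i = 0}. 0 \<le> s $ i" "\<forall>i\<in>- {i. xbar $ i = 0}. s $ i = 0"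
    using Farkas_partial_sign[of A "{i. xbar $ i = 0}" "transpose L *v l"] lT
    unfolding inner_transpose_mult by blast
  obtain U :: "real ^ 'm ^ 'k" where U: "transpose U *v l = u"
    using rank_one_matrix[OF \<open>l \<noteq> 0\<close>] by blast
  \<comment> \<open>Makes the objective values agree; \<open>l \<bullet> v = 0\<close> then rests on
    \<open>A *v xbar = b\<close> and the complementarity of \<open>s\<close> and
    \<open>xbar\<close>.\<close>
  define v where "v = L *v xbar - U *v b"
  have "s \<bullet> xbar = 0"
    using s(2) by (auto simp: inner_vec_def intro!: sum.neutral)
  have "l \<bullet> v = (transpose L *v l) \<bullet> xbar - (transpose U *v l) \<bullet> b"
    by (simp only: v_def inner_diff_right inner_transpose_mult)
  also have "\<dots> = u \<bullet> (A *v xbar) + s \<bullet> xbar - u \<bullet> b"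
    by (simp only: us U inner_add_left inner_transpose_mult)
  also have "\<dots> = 0" by (simp add: xA \<open>s \<bullet> xbar = 0\<close>)
  finally have lv: "l \<bullet> v = 0" .
  have "transpose (L - U ** A) *v l = s"
  proof (rule vector_eq_ldot[THEN iffD1], intro allI)
    fix z
    have "z \<bullet> (transpose (L - U ** A) *v l) = l \<bullet> (L *v z) - l \<bullet> (U *v (A *v z))"
      by (simp only: inner_commute[of z] inner_transpose_mult matrix_vector_mult_diff_rdistrib
          inner_diff_right matrix_vector_mul_assoc)
    also have "\<dots> = (transpose L *v l) \<bullet> z - (transpose A *v (transpose U *v l)) \<bullet> z"
      by (simp only: inner_transpose_mult)
    also have "\<dots> = z \<bullet> s"
      unfolding us U by (simp only: inner_add_left inner_commute[of z] add_diff_cancel_left')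
    finally show "z \<bullet> (transpose (L - U ** A) *v l) = z \<bullet> s" .
  qed
  moreover have "s \<in> nonneg_orthant"
    unfolding nonneg_orthant_def
  proof safe
    show "0 \<le> s $ i" for i using s by (cases "xbar $ i = 0") auto
  qed
  ultimately have mem: "(l, U, v) \<in> dual_feasible K L A"
    using l lv by (simp add: dual_feasible_def)
  moreover have obj: "L *v xbar = U *v b + v" by (simp add: v_def)
  \<comment> \<open>A dual point dominating this one would dominate \<open>L *v xbar\<close>,
    contrary to weak duality.\<close>
  moreover have "efficient_max K (dual_objective b) (dual_feasible K L A) (l, U, v)"
    unfolding efficient_max_def
    using mem weak_duality[OF feas, of _ K L] obj by (auto simp: dual_objective_def)
  ultimately show ?thesis by blast
qed

end
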